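(* In the risk model with interest rate described in the context, suppose that $$e^{-r(t)}R(t)\ge u-Y(t)\quad\text{for all }t>0,\qquad Y(t):=\int_0^te^{-r(x)}\,dS(x),$$ where $Y(t)$, $t\ge0$, is a separable process with independent increments. Then for any $u>0$ and any $T,h\ge 0$, $$\psi(u,T)\le\mathbf{P}\Big(\sup_{0\le t\le T}Y(t)>u\Big)\le e^{-hu}\sup_{0\le t\le T}\mathbf{E}e^{hY(t)},$$ and for any $u>0$ and $h\ge 0$, $$\psi(u)\le\mathbf{P}\Big(\sup_{t\ge 0}Y(t)>u\Big)\le e^{-hu}\sup_{t\ge 0}\mathbf{E}e^{hY(t)}.$$
   Context: Model B: $N(t)$, $t\ge 0$, is a non-homogeneous Poisson process with non-decreasing accumulated intensity function $\Lambda(t)=\mathbf{E}N(t)<\infty$, $N(0)=\Lambda(0)=0$, with claim times $T_j=\min\{t\ge 0:N(t)\ge j\}$. $Z(t)\ge 0$ denotes the claim size in case a claim arrives at time $t$; $N(\cdot)$ and $Z(\cdot)$ are independent, and the $Z(T_j)$, $j\ge1$, are independent but not necessarily identically distributed. $p(t)\ge 0$ is the non-decreasing aggregate premium income over $[0,t]$, and $q(t)$ is the total claim amount over $[0,t]$ (the principal case being $q(t)=\sum_{j=1}^{N(t)}Z(T_j)$). The risk reserve process $R$, with $R(0)=u>0$, satisfies for all $t_2>t_1\ge 0$ $$R(t_2)=(1+\alpha(t_1,t_2))R(t_1)+(1+\beta(t_1,t_2))[p(t_2)-p(t_1)]-[q(t_2)-q(t_1)],$$ where the interest rates satisfy $\beta(t_1,t_2)\ge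 0$ and $1+\alpha(t_1,t_2)\ge e^{r(t_2)-r(t_1)}$ for a non-random non-decreasing function $r$ with $r(0)=0$. Put $S(t)=q(t)-p(t)$, assumed of bounded variation on finite intervals, so that $Y$ is defined pathwise and $Y(0)=0$. The ruin probabilities are $\psi(u)=\mathbf{P}(\inf_{t\ge 0}R(t)<0)$ and $\psi(u,T)=\mathbf{P}(\inf_{0\le t\le T}R(t)<0)$. Separable is meant in Doob's sense. Exponential moments may equal $+\infty$. *)

theory Defs
  imports "HOL-Probability.Probability"
begin

section \<open>Pathwise Lebesgue-Stieltjes integrals\<close>

definition variation_sums :: "(real \<Rightarrow> real) \<Rightarrow> real \<Rightarrow> real set" where
  "variation_sums F t =
     {\<Sum>i<n. \<bar>F (x (Suc i)) - F (x i)\<bar> | n x.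
        x 0 = 0 \<and> x n = t \<and> (\<forall>i<n. x i \<le> x (Suc i))}"

definition bounded_variation_on_finite_intervals :: "(real \<Rightarrow> real) \<Rightarrow> bool" where
  "bounded_variation_on_finite_intervals F \<longleftrightarrow> (\<forall>t\<ge>0. bdd_above (variation_sums F t))"

definition total_variation :: "(real \<Rightarrow> real) \<Rightarrow> real \<Rightarrow> real" where
  "total_variation F t = Sup (variation_sums F t)"

text \<open>
  For \<open>F\<close> non-decreasing on \<open>[0, t]\<close>, this is the Lebesgue-Stieltjes measure of \<open>F\<close> stopped
  outside \<open>[0, t]\<close>. No one-sided continuity of \<open>F\<close> is required: the point masses are
  \<open>F(x+) - F(x-)\<close> for \<open>0 < x < t\<close>, \<open>F(0+) - F(0)\<close> at \<open>0 < t\<close>, and \<open>F(t) - F(t-)\<close> at \<open>t > 0\<close>,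
  so the total mass is \<open>F(t) - F(0)\<close>. The passage to right limits is there because
  \<^const>\<open>interval_measure\<close> is meaningful only for right-continuous functions.
\<close>
definition stieltjes_measure :: "(real \<Rightarrow> real) \<Rightarrow> real \<Rightarrow> real measure" where
  "stieltjes_measure F t =
     interval_measure (\<lambda>x. Lim (at_right x) (\<lambda>y. F (max 0 (min y t))))"

text \<open>
  The integral of \<open>f\<close> with respect to \<open>F\<close> over \<open>[0, t]\<close> for \<open>F\<close> of bounded variation, through the
  decomposition \<open>F = V - (V - F)\<close> with \<open>V\<close> the total variation of \<open>F\<close>.
\<close>
definition stieltjes_integral :: "(real \<Rightarrow> real) \<Rightarrow> (real \<Rightarrow> real) \<Rightarrow> real \<Rightarrow> real" where
  "stieltjes_integral f F t =
     (LINT x:{0..t}|stieltjes_measure (total_variation F) t. f x) -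
     (LINT x:{0..t}|stieltjes_measure (\<lambda>s. total_variation F s - F s) t. f x)"


section \<open>Processes with time set \<open>[0, \<infinity>)\<close>\<close>

definition (in prob_space) independent_increments :: "(real \<Rightarrow> 'a \<Rightarrow> real) \<Rightarrow> bool" where
  "independent_increments Y \<longleftrightarrow>
     (\<forall>t\<ge>0. random_variable borel (Y t)) \<and>
     (\<forall>n (t :: nat \<Rightarrow> real). 0 \<le> t 0 \<and> (\<forall>i<n. t i < t (Suc i)) \<longrightarrow>
        indep_vars (\<lambda>_. borel) (\<lambda>i \<omega>. Y (t (Suc i)) \<omega> - Y (t i) \<omega>) {..<n})"

text \<open>
  Doob's separability, relative to the class of closed (possibly infinite) intervals: outside one
  null set, membership of the path over an open interval in a closed interval can be tested on a
  fixed countable set of times. Taking two disjoint sets for \<open>A\<close> shows that \<open>D\<close> is automatically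
  dense in \<open>[0, \<infinity>)\<close>.
\<close>
definition (in prob_space) separable_process :: "(real \<Rightarrow> 'a \<Rightarrow> real) \<Rightarrow> bool" where
  "separable_process Y \<longleftrightarrow>
     (\<forall>t\<ge>0. random_variable borel (Y t)) \<and>
     (\<exists>D \<Omega>\<^sub>0. countable D \<and> D \<subseteq> {0..} \<and> \<Omega>\<^sub>0 \<in> null_sets M \<and>
        (\<forall>\<omega>\<in>space M - \<Omega>\<^sub>0. \<forall>I A. open I \<and> is_interval I \<and> closed A \<and> is_interval A \<longrightarrow>
           (\<forall>t\<in>D \<inter> I. Y t \<omega> \<in> A) \<longrightarrow> (\<forall>t\<in>{0..} \<inter> I. Y t \<omega> \<in> A)))"

text \<open>
  The law of the increments is written out because \<^const>\<open>poisson_pmf\<close> requires a positive rate.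
  Since \<open>N 0 = 0\<close> and \<open>\<Lambda> 0 = 0\<close>, it gives that \<open>\<Lambda> t\<close> is the mean of \<open>N t\<close>.
\<close>
definition (in prob_space) nonhomogeneous_poisson_process ::
    "(real \<Rightarrow> 'a \<Rightarrow> nat) \<Rightarrow> (real \<Rightarrow> real) \<Rightarrow> bool" where
  "nonhomogeneous_poisson_process N \<Lambda> \<longleftrightarrow>
     mono_on {0..} \<Lambda> \<and> \<Lambda> 0 = 0 \<and>
     (\<forall>t\<ge>0. random_variable (count_space UNIV) (N t)) \<and>
     (AE \<omega> in M. N 0 \<omega> = 0 \<and> mono_on {0..} (\<lambda>t. N t \<omega>) \<and>
        (\<forall>t\<ge>0. continuous (at_right t) (\<lambda>s. real (N s \<omega>)))) \<and>
     independent_increments (\<lambda>t \<omega>. real (N t \<omega>)) \<and>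
     (\<forall>s t k. 0 \<le> s \<and> s < t \<longrightarrow>
        prob {\<omega> \<in> space M. N t \<omega> - N s \<omega> = k} =
          (\<Lambda> t - \<Lambda> s) ^ k / fact k * exp (- (\<Lambda> t - \<Lambda> s)))"

text \<open>
  By right-continuity the infimum is a minimum whenever the set is nonempty; otherwise the \<open>j\<close>-th
  claim never arrives and the value is meaningless.
\<close>
definition claim_time :: "(real \<Rightarrow> 'a \<Rightarrow> nat) \<Rightarrow> nat \<Rightarrow> 'a \<Rightarrow> real" where
  "claim_time N j \<omega> = Inf {t. 0 \<le> t \<and> j \<le> N t \<omega>}"


section \<open>The risk model with interest rates\<close>

text \<open>
  The total claim amount \<open>q\<close> is left general; the principal case is
  \<open>q t \<omega> = (\<Sum>j=1..N t \<omega>. Z (claim_time N j \<omega>) \<omega>)\<close>.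
  When \<open>\<Lambda>\<close> is bounded, some claims never arrive and \<open>Z\<close> is not evaluated for them; hence the
  independence of the claim sizes \<open>Z(T\<^sub>j)\<close> is expressed by an independent sequence \<open>X\<close> that agrees
  with \<open>Z(T\<^sub>j)\<close> whenever the \<open>j\<close>-th claim arrives.
\<close>
locale interest_risk_model = prob_space M
  for M :: "'a measure" +
  fixes \<Lambda> :: "real \<Rightarrow> real"
    and N :: "real \<Rightarrow> 'a \<Rightarrow> nat"
    and Z :: "real \<Rightarrow> 'a \<Rightarrow> real"
    and p q :: "real \<Rightarrow> 'a \<Rightarrow> real"
    and \<alpha> \<beta> :: "real \<Rightarrow> real \<Rightarrow> 'a \<Rightarrow> real"
    and r :: "real \<Rightarrow> real"
    and u :: real
    and R :: "real \<Rightarrow> 'a \<Rightarrow> real"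
  assumes poisson: "nonhomogeneous_poisson_process N \<Lambda>"
    and Z_nonneg: "AE \<omega> in M. \<forall>t\<ge>0. 0 \<le> Z t \<omega>"
    and N_Z_indep:
      "indep_var (PiM {0..} (\<lambda>_. count_space UNIV)) (\<lambda>\<omega>. \<lambda>t\<in>{0..}. N t \<omega>)
                 (PiM {0..} (\<lambda>_. borel)) (\<lambda>\<omega>. \<lambda>t\<in>{0..}. Z t \<omega>)"
    and claims_indep:
      "\<exists>X. indep_vars (\<lambda>_. borel) X {1..} \<and>
           (\<forall>j\<ge>1. AE \<omega> in M. (\<exists>t\<ge>0. j \<le> N t \<omega>) \<longrightarrow> X j \<omega> = Z (claim_time N j \<omega>) \<omega>)"
    and p_rv: "\<And>t. 0 \<le> t \<Longrightarrow> random_variable borel (p t)"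
    and p_nonneg_mono: "AE \<omega> in M. (\<forall>t\<ge>0. 0 \<le> p t \<omega>) \<and> mono_on {0..} (\<lambda>t. p t \<omega>)"
    and q_rv: "\<And>t. 0 \<le> t \<Longrightarrow> random_variable borel (q t)"
    and bounded_variation:
      "AE \<omega> in M. bounded_variation_on_finite_intervals (\<lambda>t. q t \<omega> - p t \<omega>)"
    and r_mono: "mono_on {0..} r"
    and r_0: "r 0 = 0"
    and interest_rates:
      "AE \<omega> in M. \<forall>t1 t2. 0 \<le> t1 \<and> t1 < t2 \<longrightarrow>
         0 \<le> \<beta> t1 t2 \<omega> \<and> exp (r t2 - r t1) \<le> 1 + \<alpha> t1 t2 \<omega>"
    and u_pos: "0 < u"
    and R_rv: "\<And>t. 0 \<le> t \<Longrightarrow> random_variable borel (R t)"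
    and R_0: "AE \<omega> in M. R 0 \<omega> = u"
    and reserve:
      "AE \<omega> in M. \<forall>t1 t2. 0 \<le> t1 \<and> t1 < t2 \<longrightarrow>
         R t2 \<omega> = (1 + \<alpha> t1 t2 \<omega>) * R t1 \<omega>
                  + (1 + \<beta> t1 t2 \<omega>) * (p t2 \<omega> - p t1 \<omega>) - (q t2 \<omega> - q t1 \<omega>)"

definition discounted_loss ::
    "(real \<Rightarrow> real) \<Rightarrow> (real \<Rightarrow> 'a \<Rightarrow> real) \<Rightarrow> (real \<Rightarrow> 'a \<Rightarrow> real) \<Rightarrow> real \<Rightarrow> 'a \<Rightarrow> real" where
  "discounted_loss r p q t \<omega> =
     stieltjes_integral (\<lambda>x. exp (- r x)) (\<lambda>s. q s \<omega> - p s \<omega>) t"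

text \<open>
  Events that involve uncountably many times are measured by the completion of the probability
  measure. Extrema over time are taken in the extended reals, so that unbounded paths are covered.
  The time set \<open>J\<close> is \<open>{0..T}\<close> for ruin up to \<open>T\<close> and \<open>{0..}\<close> for ultimate ruin; the
  initial reserve is \<open>R 0\<close>.
\<close>
definition ruin_probability :: "'a measure \<Rightarrow> (real \<Rightarrow> 'a \<Rightarrow> real) \<Rightarrow> real set \<Rightarrow> ennreal" where
  "ruin_probability M R J =
     emeasure (completion M) {\<omega> \<in> space M. (INF t\<in>J. ereal (R t \<omega>)) < 0}"

definition exceedance_probability ::
    "'a measure \<Rightarrow> (real \<Rightarrow> 'a \<Rightarrow> real) \<Rightarrow> real set \<Rightarrow> real \<Rightarrow> ennreal" where
  "exceedance_probability M Y J u =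
     emeasure (completion M) {\<omega> \<in> space M. ereal u < (SUP t\<in>J. ereal (Y t \<omega>))}"

end

theory Submission
  imports Defs
begin

text \<open>
  Since \<open>exp (h * Y t) / E (exp (h * Y t))\<close> is a mean-one martingale, stopping it when \<open>Y\<close> first
  exceeds \<open>u\<close> gives \<open>1 \<ge> exp (h * u) * P (sup Y > u) / sup\<^sub>t E (exp (h * Y t))\<close>. Over finitely many
  times the stopping argument is a first-passage decomposition; separability of \<open>Y\<close> reduces the
  supremum to countably many times. Ruin forces \<open>Y\<close> above \<open>u\<close> by the assumed lower bound on \<open>R\<close>.
\<close>

section \<open>An exponential maximal inequality for partial sums\<close>

lemma (in prob_space) nn_integral_indep_var_mult:
  fixes X Y :: "'a \<Rightarrow> ennreal"
  assumes "indep_var borel X borel Y"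
  shows "(\<integral>\<^sup>+\<omega>. X \<omega> * Y \<omega> \<partial>M) = (\<integral>\<^sup>+\<omega>. X \<omega> \<partial>M) * (\<integral>\<^sup>+\<omega>. Y \<omega> \<partial>M)"
proof -
  \<comment> \<open>\<open>indep_var\<close> unfolds to a family over \<open>bool\<close> with
    target \<open>case_bool borel borel\<close>. It must become a constant family before the product
    rule for families applies.\<close>
  have "case_bool borel borel = (\<lambda>_. borel :: ennreal measure)"
    by (auto split: bool.split)
  then have "indep_vars (\<lambda>_. borel) (case_bool X Y) UNIV"
    using assms by (simp add: indep_var_def)
  from indep_vars_nn_integral[OF _ this] show ?thesis
    by (simp add: UNIV_bool mult.commute)
qed

text \<open>Split by the first index \<open>k\<close> at which the partial sum exceeds
  \<open>c\<close>. On that event \<open>A k\<close> the factor \<open>E k\<close> is at least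
  \<open>exp (h * c)\<close>, and by independence the remaining increments multiply both the full
  expectation and the one restricted to \<open>A k\<close> by the same \<open>b k\<close>. The
  weight of \<open>A k\<close> under the density proportional to \<open>E n\<close> is therefore at
  least \<open>exp (h * c) * P (A k) / K\<close>. These weights sum to at most 1, as the
  \<open>A k\<close> are disjoint.\<close>

lemma (in prob_space) emeasure_exceeds_partial_sums_le:
  fixes X :: "nat \<Rightarrow> 'a \<Rightarrow> real"
  assumes indep: "indep_vars (\<lambda>_. borel) X {..<n}" and h: "0 \<le> h"
    and K: "\<And>k. k \<le> n \<Longrightarrow> (\<integral>\<^sup>+\<omega>. ennreal (exp (h * (\<Sum>i<k. X i \<omega>))) \<partial>M) \<le> K"
  shows "emeasure M {\<omega>\<in>space M. \<exists>k\<le>n. c < (\<Sum>i<k. X i \<omega>)} \<le> ennreal (exp (- h * c)) * K"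
\<comment> \<open>An infinite \<open>K\<close> makes the right-hand side infinite, because
  \<open>exp (- h * c)\<close> is positive. A finite \<open>K\<close> permits the cancellation at
  the end.\<close>
proof (cases "K = \<top>")
  case True
  then show ?thesis
    by (simp add: ennreal_mult_top)
next
  case False
  \<comment> \<open>\<open>S\<close> and \<open>hit\<close> act on deterministic sequences, so that
    they can be evaluated on the block of the first \<open>k\<close> increments alone.\<close>
  define S where "S k x = (\<Sum>i<k. x i)" for k :: nat and x :: "nat \<Rightarrow> real"
  define hit where "hit k x \<longleftrightarrow> c < S k x \<and> (\<forall>j\<in>{..<k}. S j x \<le> c)" for k x
  define E where "E k \<omega> = ennreal (exp (h * S k (\<lambda>i. X i \<omega>)))" for k \<omega>
  define A where "A k = {\<omega>\<in>space M. hit k (\<lambda>i. X i \<omega>)}" for k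
  define b where "b k = (\<integral>\<^sup>+\<omega>. ennreal (exp (h * (\<Sum>i\<in>{k..<n}. X i \<omega>))) \<partial>M)" for k
  have [measurable]: "X i \<in> borel_measurable M" if "i < n" for i
    using indep that by (auto simp: indep_vars_def)
  have [measurable]: "(\<lambda>\<omega>. S k (\<lambda>i. X i \<omega>)) \<in> borel_measurable M" if "k \<le> n" for k
    unfolding S_def using that by (intro borel_measurable_sum) auto
  have E_meas [measurable]: "E k \<in> borel_measurable M" if "k \<le> n" for k
    unfolding E_def using that by measurable
  have A_sets [measurable]: "A k \<in> sets M" if "k \<le> n" for k
  proof -
    have "Measurable.pred M (\<lambda>\<omega>. S j (\<lambda>i. X i \<omega>) \<le> c)" if "j \<in> {..<k}" for j
    proof -
      have "j \<le> n"
        using that \<open>k \<le> n\<close> by simp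
      then show ?thesis
        by measurable
    qed
    then show ?thesis
      unfolding A_def hit_def using that by measurable
  qed
  \<comment> \<open>The index blocks \<open>{..<k}\<close> and \<open>{k..<n}\<close> are disjoint,
    so any functional of the past is independent of the exponential of the future
    increments.\<close>
  have split: "(\<integral>\<^sup>+\<omega>. F (restrict (\<lambda>i. X i \<omega>) {..<k}) *
      ennreal (exp (h * (\<Sum>i\<in>{k..<n}. X i \<omega>))) \<partial>M)
      = (\<integral>\<^sup>+\<omega>. F (restrict (\<lambda>i. X i \<omega>) {..<k}) \<partial>M) * b k"
    if "k \<le> n" "F \<in> borel_measurable (PiM {..<k} (\<lambda>_. borel))" for F k
  proof -
    let ?G = "\<lambda>x. ennreal (exp (h * (\<Sum>i\<in>{k..<n}. x i :: real)))"
    have "?G \<in> borel_measurable (PiM {k..<n} (\<lambda>_. borel))"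
      by measurable
    moreover have "indep_var (PiM {..<k} (\<lambda>_. borel)) (\<lambda>\<omega>. restrict (\<lambda>i. X i \<omega>) {..<k})
        (PiM {k..<n} (\<lambda>_. borel)) (\<lambda>\<omega>. restrict (\<lambda>i. X i \<omega>) {k..<n})"
      using that by (intro indep_var_restrict[OF indep]) auto
    ultimately have "indep_var borel (F \<circ> (\<lambda>\<omega>. restrict (\<lambda>i. X i \<omega>) {..<k}))
        borel (?G \<circ> (\<lambda>\<omega>. restrict (\<lambda>i. X i \<omega>) {k..<n}))"
      using that by (intro indep_var_compose)
    from nn_integral_indep_var_mult[OF this] show ?thesis
      by (simp add: b_def)
  qed
  have E_n: "E n \<omega> = E k \<omega> * ennreal (exp (h * (\<Sum>i\<in>{k..<n}. X i \<omega>)))" if "k \<le> n" for k \<omega>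
  proof -
    have "(\<Sum>i<n. X i \<omega>) = (\<Sum>i<k. X i \<omega>) + (\<Sum>i\<in>{k..<n}. X i \<omega>)"
      using that by (simp add: sum.atLeastLessThan_concat flip: atLeast0LessThan)
    then show ?thesis
      by (simp add: E_def S_def distrib_left exp_add ennreal_mult)
  qed
  have S_restrict: "S j (restrict x {..<k}) = S j x" if "j \<le> k" for j k x
    unfolding S_def using that by (intro sum.cong) auto
  then have hit_restrict: "hit k (restrict x {..<k}) \<longleftrightarrow> hit k x" for k x
    by (auto simp: hit_def)
  have S_meas: "S j \<in> borel_measurable (PiM {..<k} (\<lambda>_. borel))" if "j \<le> k" for j k
    unfolding S_def using that by (intro borel_measurable_sum) auto
  have m_eq: "(\<integral>\<^sup>+\<omega>. E n \<omega> \<partial>M) = (\<integral>\<^sup>+\<omega>. E k \<omega> \<partial>M) * b k" if "k \<le> n" for k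
  proof -
    have "(\<lambda>x. ennreal (exp (h * S k x))) \<in> borel_measurable (PiM {..<k} (\<lambda>_. borel))"
      using S_meas[of k k] by simp
    from split[OF that this] show ?thesis
      by (simp add: E_n[OF that] S_restrict) (simp add: E_def)
  qed
  have A_eq: "(\<integral>\<^sup>+\<omega>. E n \<omega> * indicator (A k) \<omega> \<partial>M) = (\<integral>\<^sup>+\<omega>. E k \<omega> * indicator (A k) \<omega> \<partial>M) * b k"
    if "k \<le> n" for k
  proof -
    let ?F = "\<lambda>x. if hit k x then ennreal (exp (h * S k x)) else 0"
    have [measurable]: "S k \<in> borel_measurable (PiM {..<k} (\<lambda>_. borel))"
      by (rule S_meas) simp
    have "Measurable.pred (PiM {..<k} (\<lambda>_. borel)) (\<lambda>x. S j x \<le> c)" if "j \<in> {..<k}" for j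
      using S_meas[of j k] that by simp
    then have "Measurable.pred (PiM {..<k} (\<lambda>_. borel)) (hit k)"
      unfolding hit_def by measurable
    then have "?F \<in> borel_measurable (PiM {..<k} (\<lambda>_. borel))"
      by measurable
    from split[OF that this]
    have "(\<integral>\<^sup>+\<omega>. ?F (\<lambda>i. X i \<omega>) * ennreal (exp (h * (\<Sum>i\<in>{k..<n}. X i \<omega>))) \<partial>M)
        = (\<integral>\<^sup>+\<omega>. ?F (\<lambda>i. X i \<omega>) \<partial>M) * b k"
      by (simp only: hit_restrict S_restrict order_refl)
    moreover have "?F (\<lambda>i. X i \<omega>) = E k \<omega> * indicator (A k) \<omega>" if "\<omega> \<in> space M" for \<omega>
      using that by (simp add: E_def A_def)
    ultimately show ?thesis
      by (simp add: E_n[OF that] ac_simps cong: nn_integral_cong)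
  qed
  let ?e = "ennreal (exp (h * c))" and ?m = "\<integral>\<^sup>+\<omega>. E n \<omega> \<partial>M"
  \<comment> \<open>Cross-multiplied form of the comparison: \<open>b k\<close> is a common factor
    of both sides, so nothing has to be divided in \<open>ennreal\<close>.\<close>
  have le: "?m * (?e * emeasure M (A k)) \<le> K * (\<integral>\<^sup>+\<omega>. E n \<omega> * indicator (A k) \<omega> \<partial>M)"
    if "k \<le> n" for k
  proof -
    have "?e * emeasure M (A k) = (\<integral>\<^sup>+\<omega>. ?e * indicator (A k) \<omega> \<partial>M)"
      using that by (simp add: nn_integral_cmult_indicator)
    also have "\<dots> \<le> (\<integral>\<^sup>+\<omega>. E k \<omega> * indicator (A k) \<omega> \<partial>M)"
      by (intro nn_integral_mono)
        (auto simp: E_def A_def hit_def indicator_def intro!: ennreal_leI mult_left_mono h)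
    finally have 1: "?e * emeasure M (A k) \<le> (\<integral>\<^sup>+\<omega>. E k \<omega> * indicator (A k) \<omega> \<partial>M)" .
    have "(\<integral>\<^sup>+\<omega>. E k \<omega> \<partial>M) \<le> K"
      using K[OF that] by (simp add: E_def S_def)
    then have "(\<integral>\<^sup>+\<omega>. E k \<omega> \<partial>M) * b k * (?e * emeasure M (A k))
        \<le> K * b k * (\<integral>\<^sup>+\<omega>. E k \<omega> * indicator (A k) \<omega> \<partial>M)"
      using 1 by (intro mult_mono) auto
    then show ?thesis
      by (simp add: m_eq[OF that] A_eq[OF that] ac_simps)
  qed
  have disj: "disjoint_family_on A {..n}"
    by (auto simp: disjoint_family_on_def A_def hit_def) (metis lessThan_iff linorder_neqE_nat not_less)
  have eq: "{\<omega>\<in>space M. \<exists>k\<le>n. c < (\<Sum>i<k. X i \<omega>)} = (\<Union>k\<in>{..n}. A k)" (is "?B = _")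
  proof safe
    fix \<omega> k assume \<omega>: "\<omega> \<in> space M" and k: "k \<le> n" "c < (\<Sum>i<k. X i \<omega>)"
    define l where "l = (LEAST k. c < S k (\<lambda>i. X i \<omega>))"
    have "c < S l (\<lambda>i. X i \<omega>)" "l \<le> k"
      using k unfolding l_def S_def by (auto intro: LeastI Least_le)
    moreover have "S j (\<lambda>i. X i \<omega>) \<le> c" if "j < l" for j
      using not_less_Least[of j "\<lambda>k. c < S k (\<lambda>i. X i \<omega>)"] that by (simp add: l_def not_less)
    ultimately show "\<omega> \<in> (\<Union>k\<in>{..n}. A k)"
      using \<omega> k by (auto simp: A_def hit_def intro!: bexI[of _ l])
  qed (auto simp: A_def hit_def S_def)
  have "?m * (?e * emeasure M ?B) \<le> ?m * (?e * (\<Sum>k\<le>n. emeasure M (A k)))"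
    unfolding eq by (intro mult_left_mono emeasure_subadditive_finite) auto
  also have "\<dots> = (\<Sum>k\<le>n. ?m * (?e * emeasure M (A k)))"
    by (simp add: sum_distrib_left)
  also have "\<dots> \<le> (\<Sum>k\<le>n. K * (\<integral>\<^sup>+\<omega>. E n \<omega> * indicator (A k) \<omega> \<partial>M))"
    by (intro sum_mono le) simp
  also have "\<dots> = K * (\<integral>\<^sup>+\<omega>. (\<Sum>k\<le>n. E n \<omega> * indicator (A k) \<omega>) \<partial>M)"
    by (subst nn_integral_sum) (auto simp: sum_distrib_left)
  also have "\<dots> \<le> K * ?m"
  proof -
    \<comment> \<open>At most one first-passage event contains a given \<open>\<omega>\<close>, so
      the indicators add up to at most 1.\<close>
    have "(\<Sum>k\<le>n. E n \<omega> * indicator (A k) \<omega>) \<le> E n \<omega>" for \<omega>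
    proof -
      have "(\<Sum>k\<le>n. E n \<omega> * indicator (A k) \<omega>) = E n \<omega> * indicator (\<Union>k\<in>{..n}. A k) \<omega>"
        by (simp add: indicator_UN_disjoint[OF _ disj] sum_distrib_left)
      then show ?thesis
        by (simp add: indicator_def)
    qed
    then show ?thesis
      by (intro mult_left_mono nn_integral_mono) auto
  qed
  finally have "?m * (?e * emeasure M ?B) \<le> ?m * K"
    by (simp add: mult.commute)
  \<comment> \<open>Cancelling \<open>?m\<close> needs it to be positive and finite: its integrand
    is strictly positive on a probability space, and its value is at most \<open>K\<close>.\<close>
  moreover have "?m \<noteq> 0"
    by (subst nn_integral_0_iff_AE) (auto simp: E_def AE_False)
  moreover have "?m \<noteq> \<top>"
    using K[of n] False by (auto simp: E_def S_def top_unique)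
  ultimately have "?e * emeasure M ?B \<le> K"
    by (simp add: ennreal_mult_le_mult_iff)
  then have "ennreal (exp (- h * c)) * (?e * emeasure M ?B) \<le> ennreal (exp (- h * c)) * K"
    by (intro mult_left_mono) auto
  moreover have "ennreal (exp (- h * c)) * ?e = 1"
    by (simp add: exp_minus flip: ennreal_mult)
  ultimately show ?thesis
    by (simp flip: mult.assoc)
qed

section \<open>From partial sums to countable sets of times\<close>

text \<open>Listed in increasing order, the times start at 0, where \<open>Y\<close> vanishes. The
  values of \<open>Y\<close> are then the partial sums of its independent increments.\<close>

lemma (in prob_space) emeasure_exceeds_finite_le:
  fixes Y :: "real \<Rightarrow> 'a \<Rightarrow> real"
  assumes incr: "independent_increments Y" and Y_0: "\<And>\<omega>. Y 0 \<omega> = 0"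
    and F: "finite F" "F \<subseteq> {0..}" "0 \<in> F" and h: "0 \<le> h"
    and K: "\<And>t. t \<in> F \<Longrightarrow> (\<integral>\<^sup>+\<omega>. ennreal (exp (h * Y t \<omega>)) \<partial>M) \<le> K"
  shows "emeasure M {\<omega>\<in>space M. \<exists>t\<in>F. c < Y t \<omega>} \<le> ennreal (exp (- h * c)) * K"
proof -
  define t where "t = (!) (sorted_list_of_set F)"
  \<comment> \<open>\<open>n\<close> counts increments, one fewer than the times; \<open>F\<close>
    contains 0, so its cardinality is positive.\<close>
  define n where "n = card F - 1"
  have card: "card F = Suc n"
    using F by (cases "card F") (auto simp: n_def)
  have F_eq: "F = t ` {..n}"
    using F card nth_image[of "card F" "sorted_list_of_set F"]
    by (simp add: t_def atLeast0LessThan lessThan_Suc_atMost)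
  have less: "t i < t j" if "i < j" "j \<le> n" for i j
    using that card sorted_wrt_nth_less[OF strict_sorted_list_of_set[of F], of i j]
    by (simp add: t_def)
  \<comment> \<open>The time 0 occurs in the list. No time is negative and the list increases
    strictly, so it can only come first.\<close>
  obtain i where i: "i \<le> n" "t i = 0"
    using F F_eq by (metis atMost_iff imageE)
  have t_ge: "0 \<le> t j" if "j \<le> n" for j
    using F(2) F_eq that by auto
  have t_0: "t 0 = 0"
    using less[of 0 i] i t_ge[of 0] by (cases i) auto
  have "indep_vars (\<lambda>_. borel) (\<lambda>i \<omega>. Y (t (Suc i)) \<omega> - Y (t i) \<omega>) {..<n}"
    using incr less t_0 unfolding independent_increments_def by auto
  moreover have S: "(\<Sum>i<k. Y (t (Suc i)) \<omega> - Y (t i) \<omega>) = Y (t k) \<omega>" for k \<omega>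
    using sum_lessThan_telescope[of "\<lambda>i. Y (t i) \<omega>" k] by (simp add: t_0 Y_0)
  ultimately have "emeasure M {\<omega>\<in>space M. \<exists>k\<le>n. c < Y (t k) \<omega>} \<le> ennreal (exp (- h * c)) * K"
    using emeasure_exceeds_partial_sums_le[where X = "\<lambda>i \<omega>. Y (t (Suc i)) \<omega> - Y (t i) \<omega>", OF _ h] K
    by (simp add: S F_eq)
  moreover have "{\<omega>\<in>space M. \<exists>k\<le>n. c < Y (t k) \<omega>} = {\<omega>\<in>space M. \<exists>t\<in>F. c < Y t \<omega>}"
    by (auto simp: F_eq)
  ultimately show ?thesis
    by simp
qed

text \<open>The bound for finite sets of times does not depend on their size, so it survives
  continuity from below along an increasing exhaustion of \<open>C\<close>.\<close>

lemma (in prob_space) emeasure_exceeds_countable_le: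
  fixes Y :: "real \<Rightarrow> 'a \<Rightarrow> real"
  assumes incr: "independent_increments Y" and Y_0: "\<And>\<omega>. Y 0 \<omega> = 0"
    and C: "countable C" "C \<subseteq> {0..}" "0 \<in> C" and h: "0 \<le> h"
    and K: "\<And>t. t \<in> C \<Longrightarrow> (\<integral>\<^sup>+\<omega>. ennreal (exp (h * Y t \<omega>)) \<partial>M) \<le> K"
  shows "emeasure M {\<omega>\<in>space M. \<exists>t\<in>C. c < Y t \<omega>} \<le> ennreal (exp (- h * c)) * K"
proof -
  \<comment> \<open>Inserting 0 gives every stage, including the first, the starting time that the
    finite case requires.\<close>
  define F where "F n = insert 0 (from_nat_into C ` {..<n})" for n
  define B where "B n = {\<omega>\<in>space M. \<exists>t\<in>F n. c < Y t \<omega>}" for n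
  have range_C: "range (from_nat_into C) = C"
    using C by (intro range_from_nat_into) auto
  have C_eq: "C = (\<Union>n. F n)"
  proof -
    have "(\<Union>n. F n) = insert 0 (range (from_nat_into C))"
      by (fastforce simp: F_def)
    then show ?thesis
      using C(3) range_C by auto
  qed
  have [measurable]: "Y t \<in> borel_measurable M" if "0 \<le> t" for t
    using incr that by (simp add: independent_increments_def)
  have FC: "F n \<subseteq> C" for n
    using C_eq by auto
  have "B n \<in> sets M" for n
  proof -
    have "Measurable.pred M (\<lambda>\<omega>. c < Y t \<omega>)" if "t \<in> F n" for t
    proof -
      have "0 \<le> t"
        using that FC C(2) by force
      then show ?thesis
        by measurable
    qed
    moreover have "finite (F n)"
      by (simp add: F_def)
    ultimately show ?thesis
      unfolding B_def by measurable
  qed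
  moreover have "incseq B"
    by (auto simp: incseq_def B_def F_def)
  ultimately have "(SUP n. emeasure M (B n)) = emeasure M (\<Union>n. B n)"
    by (intro SUP_emeasure_incseq) auto
  moreover have "(\<Union>n. B n) = {\<omega>\<in>space M. \<exists>t\<in>C. c < Y t \<omega>}"
    by (auto simp: B_def C_eq)
  moreover have "(SUP n. emeasure M (B n)) \<le> ennreal (exp (- h * c)) * K"
    unfolding B_def using FC C(2)
    by (intro SUP_least emeasure_exceeds_finite_le[OF incr Y_0] h K) (auto simp: F_def)
  ultimately show ?thesis
    by simp
qed

section \<open>Separability, suprema over intervals, and ruin\<close>

text \<open>A separable path that stays in the closed interval \<open>{..c}\<close> at the
  separating times of an open interval stays there throughout that interval. Up to a null set,
  exceeding \<open>c\<close> is thus visible on a countable \<open>C\<close>. The time 0 is put into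
  \<open>C\<close> so that the maximal inequality can be applied to it.\<close>

lemma (in prob_space) exceedance_countable:
  fixes Y :: "real \<Rightarrow> 'a \<Rightarrow> real"
  assumes "separable_process Y" and J: "J = {0..} \<or> (\<exists>T\<ge>0. J = {0..T})"
  obtains C where "countable C" "C \<subseteq> J" "0 \<in> C"
    "{\<omega>\<in>space M. ereal c < (SUP t\<in>J. ereal (Y t \<omega>))} \<in> sets (completion M)"
    "exceedance_probability M Y J c \<le> emeasure M {\<omega>\<in>space M. \<exists>t\<in>C. c < Y t \<omega>}"
proof -
  have [measurable]: "random_variable borel (Y t)" if "0 \<le> t" for t
    using assms(1) that by (simp add: separable_process_def)
  obtain D \<Omega> where D: "countable D" "D \<subseteq> {0..}" and \<Omega>: "\<Omega> \<in> null_sets M"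
    and sep: "\<forall>\<omega>\<in>space M - \<Omega>. \<forall>I A. open I \<and> is_interval I \<and> closed A \<and> is_interval A \<longrightarrow>
      (\<forall>t\<in>D \<inter> I. Y t \<omega> \<in> A) \<longrightarrow> (\<forall>t\<in>{0..} \<inter> I. Y t \<omega> \<in> A)"
    using assms(1) unfolding separable_process_def by metis
  \<comment> \<open>Separability speaks of open intervals only. For \<open>{0..T}\<close> the
    interval \<open>{..<T}\<close> covers all times but \<open>T\<close>, which goes into the finite
    set \<open>P\<close> and is tested directly.\<close>
  obtain I :: "real set" and P where I: "open I" "is_interval I" "finite P" "J = ({0..} \<inter> I) \<union> P" "0 \<in> J"
  proof (cases "J = {0..}")
    case True
    with that[of UNIV "{}"] show ?thesis by simp
  next
    case False
    then obtain T where T: "0 \<le> T" "J = {0..T}" using J by auto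
    then have "J = ({0..} \<inter> {..<T}) \<union> {T}" by auto
    with that[of "{..<T}" "{T}"] T show ?thesis by (auto simp: is_interval_io order_le_less)
  qed
  define C where "C = insert 0 ((D \<inter> I) \<union> P)"
  let ?E = "{\<omega>\<in>space M. ereal c < (SUP t\<in>J. ereal (Y t \<omega>))}"
  let ?B = "{\<omega>\<in>space M. \<exists>t\<in>C. c < Y t \<omega>}"
  have CJ: "C \<subseteq> J"
    using D I by (auto simp: C_def)
  have J0: "J \<subseteq> {0..}"
    using J by auto
  have E_eq: "?E = {\<omega>\<in>space M. \<exists>t\<in>J. c < Y t \<omega>}"
    by (simp add: less_SUP_iff)
  have C: "countable C"
    using D(1) I(3) by (auto simp: C_def intro: countable_finite)
  have "Measurable.pred M (\<lambda>\<omega>. c < Y t \<omega>)" if "t \<in> C" for t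
  proof -
    have "0 \<le> t"
      using that CJ J0 by force
    then show ?thesis
      by measurable
  qed
  with C have B: "?B \<in> sets M"
    by measurable
  have EB: "?E - \<Omega> \<subseteq> ?B"
  proof (rule subsetI, rule ccontr)
    fix \<omega> assume E: "\<omega> \<in> ?E - \<Omega>" and "\<omega> \<notin> ?B"
    then have "\<not> (\<exists>s\<in>C. c < Y s \<omega>)"
      by blast
    then have "Y s \<omega> \<le> c" if "s \<in> C" for s
      using that not_less by blast
    with E obtain t where \<omega>: "\<omega> \<in> space M - \<Omega>" "t \<in> J" "c < Y t \<omega>"
        "\<And>s. s \<in> C \<Longrightarrow> Y s \<omega> \<le> c"
      unfolding E_eq by blast
    show False
    proof (cases "t \<in> P")
      case True
      with \<omega>(3) \<omega>(4)[of t] show ?thesis by (simp add: C_def)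
    next
      case False
      have "(\<forall>t\<in>D \<inter> I. Y t \<omega> \<in> {..c}) \<longrightarrow> (\<forall>t\<in>{0..} \<inter> I. Y t \<omega> \<in> {..c})"
        using sep[rule_format, OF \<omega>(1)] I(1,2) by (blast intro: closed_atMost is_interval_ic)
      moreover have "\<forall>t\<in>D \<inter> I. Y t \<omega> \<in> {..c}"
        using \<omega>(4) by (simp add: C_def)
      moreover have "t \<in> {0..} \<inter> I"
        using False \<omega>(2) I(4) by blast
      ultimately have "Y t \<omega> \<in> {..c}"
        by blast
      with \<omega>(3) show ?thesis by simp
    qed
  qed
  have "?B \<subseteq> ?E"
    unfolding E_eq using CJ by auto
  \<comment> \<open>The exceedance event differs from the measurable \<open>?B\<close> by a subset
    of the null set \<open>\<Omega>\<close>, hence is measurable in the completion.\<close>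
  with EB have "?E = ?B \<union> (?E \<inter> \<Omega>)"
    by auto
  then have E: "?E \<in> sets (completion M)"
    using \<Omega> B by (intro sets_completionI[of _ ?B "?E \<inter> \<Omega>" \<Omega>]) auto
  have "AE \<omega> in completion M. \<omega> \<notin> \<Omega>"
    using \<Omega> by (intro AE_completion AE_not_in)
  then have "emeasure (completion M) ?E \<le> emeasure (completion M) ?B"
    using EB B by (intro emeasure_mono_AE) (auto elim!: eventually_mono)
  also have "\<dots> = emeasure M ?B"
    using B by simp
  finally show thesis
    using that[of C] C CJ E by (auto simp: exceedance_probability_def C_def)
qed

lemma (in prob_space) exceedance_probability_le:
  fixes Y :: "real \<Rightarrow> 'a \<Rightarrow> real"
  assumes "separable_process Y" "independent_increments Y" "\<And>\<omega>. Y 0 \<omega> = 0" "0 \<le> h"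
    and J: "J = {0..} \<or> (\<exists>T\<ge>0. J = {0..T})"
  shows "exceedance_probability M Y J c \<le>
    ennreal (exp (- h * c)) * (SUP t\<in>J. \<integral>\<^sup>+\<omega>. ennreal (exp (h * Y t \<omega>)) \<partial>M)"
proof -
  obtain C where C: "countable C" "C \<subseteq> J" "0 \<in> C"
    and le: "exceedance_probability M Y J c \<le> emeasure M {\<omega>\<in>space M. \<exists>t\<in>C. c < Y t \<omega>}"
    by (rule exceedance_countable[OF assms(1) J])
  note le
  \<comment> \<open>The supremum of the moments over \<open>J\<close> serves as \<open>K\<close> for
    every time in \<open>C\<close>.\<close>
  also have "emeasure M {\<omega>\<in>space M. \<exists>t\<in>C. c < Y t \<omega>} \<le>
    ennreal (exp (- h * c)) * (SUP t\<in>J. \<integral>\<^sup>+\<omega>. ennreal (exp (h * Y t \<omega>)) \<partial>M)"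
    using C J assms(2-4) by (intro emeasure_exceeds_countable_le) (auto intro!: SUP_upper)
  finally show ?thesis .
qed

text \<open>
  For a ruin event that is not measurable in the completion the left-hand side is the junk value
  \<open>0\<close>; measurability of the exceedance event is what makes the inequality meaningful.
\<close>
lemma (in prob_space) ruin_probability_le_exceedance_probability:
  fixes Y R :: "real \<Rightarrow> 'a \<Rightarrow> real"
  assumes "separable_process Y" and J: "J = {0..} \<or> (\<exists>T\<ge>0. J = {0..T})"
    and R_0: "AE \<omega> in M. 0 \<le> R 0 \<omega>"
    and lower: "AE \<omega> in M. \<forall>t>0. u - Y t \<omega> \<le> exp (- r t) * R t \<omega>"
  shows "ruin_probability M R J \<le> exceedance_probability M Y J u"
proof -
  have "{\<omega>\<in>space M. ereal u < (SUP t\<in>J. ereal (Y t \<omega>))} \<in> sets (completion M)"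
    by (rule exceedance_countable[OF assms(1) J])
  moreover have "AE \<omega> in completion M. (INF t\<in>J. ereal (R t \<omega>)) < 0 \<longrightarrow>
      ereal u < (SUP t\<in>J. ereal (Y t \<omega>))"
    using AE_completion[OF R_0] AE_completion[OF lower]
  proof eventually_elim
    case (elim \<omega>)
    show ?case
    proof
      assume "(INF t\<in>J. ereal (R t \<omega>)) < 0"
      then obtain t where t: "t \<in> J" "R t \<omega> < 0"
        by (auto simp: INF_less_iff)
      \<comment> \<open>The lower bound on the reserve is assumed for positive times only; ruin at
        time 0 is excluded by the nonnegative initial reserve.\<close>
      with J elim(1) have "0 < t"
        by (cases "t = 0") auto
      with elim(2) have "u - Y t \<omega> \<le> exp (- r t) * R t \<omega>"
        by blast
      also have "\<dots> < 0"
        using t by (simp add: mult_pos_neg)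
      finally show "ereal u < (SUP t\<in>J. ereal (Y t \<omega>))"
        using t by (auto simp: less_SUP_iff)
    qed
  qed
  ultimately show ?thesis
    unfolding ruin_probability_def exceedance_probability_def
    by (intro emeasure_mono_AE) (auto elim!: eventually_mono)
qed

section \<open>The discounted loss at time 0 and the two bounds\<close>

text \<open>Stopping outside \<open>[0, 0]\<close> leaves a constant function, whose interval
  measure gives \<open>{0}\<close> no mass. No regularity of \<open>F\<close> enters, so the
  discounted loss starts at 0 for every \<open>\<omega>\<close> and not merely almost
  surely.\<close>

lemma stieltjes_integral_at_0: "stieltjes_integral f F 0 = 0"
proof -
  have "(LINT x:{0..0}|stieltjes_measure G 0. f x) = 0" for G
  proof -
    have "stieltjes_measure G 0 = interval_measure (\<lambda>_. G 0)"
    proof -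
      have "max 0 (min y 0) = (0 :: real)" for y
        by simp
      moreover have "Lim (at_right x) (\<lambda>_. G 0) = G 0" for x :: real
        by (intro tendsto_Lim) auto
      ultimately show ?thesis
        by (simp add: stieltjes_measure_def)
    qed
    \<comment> \<open>The point 0 lies in \<open>{-1<..0}\<close>, whose mass is the increment
      \<open>G 0 - G 0\<close>.\<close>
    moreover have "emeasure (interval_measure (\<lambda>_. G 0)) {0} = 0"
      by (rule emeasure_eq_0[of "{-1<..0}"])
        (auto simp: emeasure_interval_measure_Ioc)
    ultimately have "{0} \<in> null_sets (stieltjes_measure G 0)"
      by auto
    then have "AE x in stieltjes_measure G 0. x \<notin> {0}"
      by (rule AE_not_in)
    then show ?thesis
      unfolding set_lebesgue_integral_def
      by (intro integral_eq_zero_AE) (auto elim!: eventually_mono)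
  qed
  then show ?thesis
    unfolding stieltjes_integral_def by simp
qed

theorem theorem2p3:
  fixes M :: "'a measure"
    and \<Lambda> r :: "real \<Rightarrow> real"
    and N :: "real \<Rightarrow> 'a \<Rightarrow> nat"
    and Z p q R Y :: "real \<Rightarrow> 'a \<Rightarrow> real"
    and \<alpha> \<beta> :: "real \<Rightarrow> real \<Rightarrow> 'a \<Rightarrow> real"
    and u :: real
  assumes model: "interest_risk_model M \<Lambda> N Z p q \<alpha> \<beta> r u R"
    and Y_eq: "Y = discounted_loss r p q"
    and lower_bound: "AE \<omega> in M. \<forall>t>0. u - Y t \<omega> \<le> exp (- r t) * R t \<omega>"
    and separable: "prob_space.separable_process M Y"
    and increments: "prob_space.independent_increments M Y"
  shows "\<forall>h\<ge>0.
     (\<forall>T\<ge>0.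
        ruin_probability M R {0..T} \<le> exceedance_probability M Y {0..T} u \<and>
        exceedance_probability M Y {0..T} u \<le>
          ennreal (exp (- h * u)) *
            (SUP t\<in>{0..T}. \<integral>\<^sup>+\<omega>. ennreal (exp (h * Y t \<omega>)) \<partial>M)) \<and>
     ruin_probability M R {0..} \<le> exceedance_probability M Y {0..} u \<and>
     exceedance_probability M Y {0..} u \<le>
       ennreal (exp (- h * u)) *
         (SUP t\<in>{0..}. \<integral>\<^sup>+\<omega>. ennreal (exp (h * Y t \<omega>)) \<partial>M)"
proof -
  interpret interest_risk_model M \<Lambda> N Z p q \<alpha> \<beta> r u R
    by (rule model)
  have Y_0: "Y 0 \<omega> = 0" for \<omega>
    by (simp add: Y_eq discounted_loss_def stieltjes_integral_at_0)
  have "AE \<omega> in M. 0 \<le> R 0 \<omega>"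
    using R_0 u_pos by (auto elim!: eventually_mono)
  then have "ruin_probability M R J \<le> exceedance_probability M Y J u"
    if "J = {0..} \<or> (\<exists>T\<ge>0. J = {0..T})" for J
    using ruin_probability_le_exceedance_probability separable that lower_bound by blast
  moreover have "exceedance_probability M Y J u \<le>
      ennreal (exp (- h * u)) * (SUP t\<in>J. \<integral>\<^sup>+\<omega>. ennreal (exp (h * Y t \<omega>)) \<partial>M)"
    if "0 \<le> h" "J = {0..} \<or> (\<exists>T\<ge>0. J = {0..T})" for h J
    using exceedance_probability_le[OF separable increments Y_0 that] .
  ultimately show ?thesis
    by blast
qed

end
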